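(* Let $\epsilon>0$ and $\eta_1,\eta_2>0$. Let $\Psi_1=\gamma_1\circ\phi_1\in\mathcal{S}^\epsilon_{\eta_1}$ (with $\phi_1:\mathbb{R}^m\to\mathbb{R}^t$ an $\epsilon$-stabilizer and $\gamma_1:\mathbb{R}^t\to\mathbb{R}^n$), let $\Psi_2\in\mathcal{R}_{\eta_2}$, and let $\mathcal{T}=\phi_1(\mathcal{Y})$. If $$C^\epsilon_{\phi_1}\in\left[0,\ \frac{C^\epsilon_{\Psi_2}}{L^\epsilon(\gamma_1,\mathcal{T})}\right],$$ then $$C^\epsilon_{\Psi_1}\le C^\epsilon_{\Psi_2}.$$
   Context: Setting: $m\ge n$, $A\in\mathbb{R}^{m\times n}$ is a full-rank matrix, $\|\cdot\|$ is the Euclidean norm. $\mathcal{X}\subseteq\mathbb{R}^n$ is a fixed set and $\mathcal{Y}=\{Ax: x\in\mathcal{X}\}$ is assumed to have no isolated points. A reconstructor is a continuous function $\Psi:\mathbb{R}^m\to\mathbb{R}^n$. It is $\eta^{-1}$-accurate, with $\eta>0$, if $\eta=\sup_{x\in\mathcal{X}}\|\Psi(Ax)-x\|$ (assumed finite). $\mathcal{R}_\eta$ is the set of $\eta^{-1}$-accurate reconstructors. For $\epsilon>0$, the $\epsilon$-stability constant of an $\eta^{-1}$-accurate reconstructor $\Psi$ is $$C^\epsilon_\Psi=\sup_{x\in\mathcal{X},\ 0<\|e\|\le\epsilon}\frac{\|\Psi(Ax+e)-x\|-\eta}{\|e\|},\qquad e\in\mathbb{R}^m,$$ assumed finite. A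 continuous function $\phi:\mathbb{R}^m\to\mathbb{R}^t$ is an $\epsilon$-stabilizer of a reconstructor $\Psi$ if (1) there is a constant $C\in[0,1)$ such that for all $x\in\mathcal{X}$ and all $e\in\mathbb{R}^m$ with $\|e\|\le\epsilon$ there is $e'\in\mathbb{R}^t$ with $\|e'\|\le C\|e\|$ and $\phi(Ax+e)=\phi(Ax)+e'$; and (2) there is $\gamma:\mathbb{R}^t\to\mathbb{R}^n$ with $\Psi=\gamma\circ\phi$. The smallest constant $C$ for which (1) holds is denoted $C^\epsilon_\phi$. $\mathcal{S}^\epsilon_\eta$ is the set of $\Psi\in\mathcal{R}_\eta$ that can be written $\Psi=\gamma\circ\phi$ with $\phi$ an $\epsilon$-stabilizer. For $\gamma:\mathbb{R}^t\to\mathbb{R}^n$ and $\mathcal{T}\subseteq\mathbb{R}^t$, the local Lipschitz constant is $L^\epsilon(\gamma,\mathcal{T})=\sup\{\|\gamma(z)-\gamma(y)\|/\|z-y\| : y\in\mathcal{T},\ z\in\mathbb{R}^t,\ 0<\|z-y\|\le\epsilon\}$, here assumed finite and nonzero. *)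

theory Defs
  imports "HOL-Analysis.Analysis"
begin

(* Suprema are taken in the extended reals, where the supremum of the empty set is
   -\<infinity> and an unbounded set has supremum \<infinity>.  A supremum is "finite" if its
   absolute value differs from \<infinity>. *)

(* The equation with the finite value \<eta> expresses finiteness of the supremum and forces
   X to be nonempty. *)
definition reconstructors ::
  "real^'n^'m \<Rightarrow> (real^'n) set \<Rightarrow> real \<Rightarrow> (real^'m \<Rightarrow> real^'n) set" where
  "reconstructors A X \<eta> =
     {\<Psi>. continuous_on UNIV \<Psi> \<and> \<eta> > 0 \<and>
         (SUP x\<in>X. ereal (norm (\<Psi> (A *v x) - x))) = ereal \<eta>}"

definition stability_const ::
  "real^'n^'m \<Rightarrow> (real^'n) set \<Rightarrow> real \<Rightarrow> real \<Rightarrow> (real^'m \<Rightarrow> real^'n) \<Rightarrow> ereal" where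
  "stability_const A X \<epsilon> \<eta> \<Psi> =
     (SUP (x, e) \<in> X \<times> {e. 0 < norm e \<and> norm e \<le> \<epsilon>}.
        ereal ((norm (\<Psi> (A *v x + e) - x) - \<eta>) / norm e))"

definition contracts_errors ::
  "real^'n^'m \<Rightarrow> (real^'n) set \<Rightarrow> real \<Rightarrow> (real^'m \<Rightarrow> real^'t) \<Rightarrow> real \<Rightarrow> bool" where
  "contracts_errors A X \<epsilon> \<phi> C \<longleftrightarrow>
     0 \<le> C \<and> C < 1 \<and>
     (\<forall>x\<in>X. \<forall>e. norm e \<le> \<epsilon> \<longrightarrow>
        (\<exists>e'. norm e' \<le> C * norm e \<and> \<phi> (A *v x + e) = \<phi> (A *v x) + e'))"

definition is_stabilizer ::
  "real^'n^'m \<Rightarrow> (real^'n) set \<Rightarrow> real \<Rightarrow> (real^'m \<Rightarrow> real^'n) \<Rightarrow> (real^'m \<Rightarrow> real^'t) \<Rightarrow> bool" where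
  "is_stabilizer A X \<epsilon> \<Psi> \<phi> \<longleftrightarrow>
     continuous_on UNIV \<phi> \<and>
     (\<exists>C. contracts_errors A X \<epsilon> \<phi> C) \<and>
     (\<exists>\<gamma>. \<Psi> = \<gamma> \<circ> \<phi>)"

(* For a stabilizer the least constant exists: e' is determined by x and e, so the admissible
   constants in [0,1) are cut out by closed conditions C * norm e \<ge> norm e'. *)
definition stabilizer_const ::
  "real^'n^'m \<Rightarrow> (real^'n) set \<Rightarrow> real \<Rightarrow> (real^'m \<Rightarrow> real^'t) \<Rightarrow> real" where
  "stabilizer_const A X \<epsilon> \<phi> = (LEAST C. contracts_errors A X \<epsilon> \<phi> C)"

(* The intermediate dimension t = CARD('t) of the factorisation is a type and so cannot be
   quantified inside the definition; it is passed as a type argument.  The set of all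
   reconstructors admitting a stabilizer is the union of these sets over all finite 't. *)
definition stabilized_reconstructors ::
  "'t::finite itself \<Rightarrow> real^'n^'m \<Rightarrow> (real^'n) set \<Rightarrow> real \<Rightarrow> real \<Rightarrow> (real^'m \<Rightarrow> real^'n) set" where
  "stabilized_reconstructors _ A X \<epsilon> \<eta> =
     {\<Psi> \<in> reconstructors A X \<eta>.
        \<exists>(\<phi> :: real^'m \<Rightarrow> real^'t) \<gamma>. is_stabilizer A X \<epsilon> \<Psi> \<phi> \<and> \<Psi> = \<gamma> \<circ> \<phi>}"

definition local_lipschitz_const ::
  "real \<Rightarrow> (real^'t \<Rightarrow> real^'n) \<Rightarrow> (real^'t) set \<Rightarrow> ereal" where
  "local_lipschitz_const \<epsilon> \<gamma> T =
     (SUP (y, z) \<in> {(y, z). y \<in> T \<and> 0 < norm (z - y) \<and> norm (z - y) \<le> \<epsilon>}.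
        ereal (norm (\<gamma> z - \<gamma> y) / norm (z - y)))"

end

theory Submission
  imports Defs
begin

text \<open>
  By accuracy, \<open>\<parallel>\<Psi>\<^sub>1 (A x + e) - x\<parallel> - \<eta>\<^sub>1 \<le> \<parallel>\<Psi>\<^sub>1 (A x + e) - \<Psi>\<^sub>1 (A x)\<parallel>\<close>. As \<open>\<phi>\<^sub>1\<close> shrinks
  \<open>e\<close> to an error of norm at most \<open>C \<parallel>e\<parallel> \<le> \<epsilon>\<close>, where \<open>C\<close> is the stabilizer constant, the local
  Lipschitz bound for \<open>\<gamma>\<^sub>1\<close> applies at \<open>\<phi>\<^sub>1 (A x) \<in> T\<close> and bounds the right-hand side by
  \<open>L C \<parallel>e\<parallel>\<close>. Hence the stability constant of \<open>\<Psi>\<^sub>1\<close> is at most \<open>L C\<close>.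
\<close>

text \<open>The witness \<open>e'\<close> can only be the difference of the two values of
  \<open>\<phi>\<close>, so the existential collapses to a norm inequality that is closed in
  \<open>C\<close>.\<close>

lemma contracts_errors_iff:
  fixes \<phi> :: "real^'m \<Rightarrow> real^'t"
  shows "contracts_errors A X \<epsilon> \<phi> C \<longleftrightarrow>
     0 \<le> C \<and> C < 1 \<and>
     (\<forall>x\<in>X. \<forall>e. norm e \<le> \<epsilon> \<longrightarrow> norm (\<phi> (A *v x + e) - \<phi> (A *v x)) \<le> C * norm e)"
proof -
  have "(\<exists>e'. norm e' \<le> r \<and> a = b + e') \<longleftrightarrow> norm (a - b) \<le> r" for a b :: "real^'t" and r
    by (metis add_diff_cancel_left' add.commute diff_add_cancel)
  then show ?thesis
    unfolding contracts_errors_def by simp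
qed

text \<open>\<open>LEAST\<close> yields something usable only if a minimum exists. The infimum of
  the admissible constants is itself admissible, since each condition is a non-strict lower bound on
  \<open>C\<close>.\<close>

lemma contracts_errors_stabilizer_const:
  assumes "contracts_errors A X \<epsilon> \<phi> C"
  shows "contracts_errors A X \<epsilon> \<phi> (stabilizer_const A X \<epsilon> \<phi>)"
proof -
  define S where "S = {C. contracts_errors A X \<epsilon> \<phi> C}"
  have ne: "S \<noteq> {}" and bdd: "bdd_below S"
    using assms by (auto simp: S_def contracts_errors_iff intro!: bdd_belowI[of _ 0])
  have low: "Inf S \<le> c" if "contracts_errors A X \<epsilon> \<phi> c" for c
    using that bdd by (auto simp: S_def intro: cInf_lower)
  have "norm (\<phi> (A *v x + e) - \<phi> (A *v x)) \<le> Inf S * norm e"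
    if "x \<in> X" "norm e \<le> \<epsilon>" for x e
  proof (cases "e = 0")
    case False
    \<comment> \<open>For fixed \<open>x\<close> and \<open>e \<noteq> 0\<close> this ratio is a
      lower bound of \<open>S\<close>, hence at most its infimum.\<close>
    have "norm (\<phi> (A *v x + e) - \<phi> (A *v x)) / norm e \<le> Inf S"
      using False that ne
      by (intro cInf_greatest) (auto simp: S_def contracts_errors_iff pos_divide_le_eq)
    then show ?thesis
      using False by (simp add: pos_divide_le_eq)
  qed simp
  moreover have "0 \<le> Inf S"
    using ne by (intro cInf_greatest) (auto simp: S_def contracts_errors_iff)
  \<comment> \<open>An infimum need not inherit a strict bound from below, but this bound is from
    above: \<open>Inf S \<le> C < 1\<close>.\<close>
  moreover have "Inf S < 1"
    using low[OF assms] assms by (auto simp: contracts_errors_iff)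
  ultimately have "contracts_errors A X \<epsilon> \<phi> (Inf S)"
    by (simp add: contracts_errors_iff)
  moreover from this have "stabilizer_const A X \<epsilon> \<phi> = Inf S"
    unfolding stabilizer_const_def using low by (rule Least_equality)
  ultimately show ?thesis
    by simp
qed

lemma reconstructors_error_le:
  assumes "\<Psi> \<in> reconstructors A X \<eta>" "x \<in> X"
  shows "norm (\<Psi> (A *v x) - x) \<le> \<eta>"
proof -
  have "ereal (norm (\<Psi> (A *v x) - x)) \<le> (SUP x\<in>X. ereal (norm (\<Psi> (A *v x) - x)))"
    using assms(2) by (rule SUP_upper)
  with assms(1) show ?thesis
    by (simp add: reconstructors_def)
qed

text \<open>The supremum leaves out \<open>z = y\<close>, where the product form holds trivially, so
  callers need not assume the points distinct.\<close>

lemma local_lipschitz_const_bound: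
  assumes "local_lipschitz_const \<epsilon> \<gamma> T = ereal L" "y \<in> T" "norm (z - y) \<le> \<epsilon>"
  shows "norm (\<gamma> z - \<gamma> y) \<le> L * norm (z - y)"
proof (cases "z = y")
  case False
  have "ereal (norm (\<gamma> z - \<gamma> y) / norm (z - y)) \<le> local_lipschitz_const \<epsilon> \<gamma> T"
    unfolding local_lipschitz_const_def using assms False
    by (intro SUP_upper2[of "(y, z)"]) auto
  then show ?thesis
    using assms(1) False by (simp add: pos_divide_le_eq)
qed simp

text \<open>Finiteness excludes the empty supremum, which is \<open>-\<infinity>\<close>.\<close>

lemma local_lipschitz_const_nonneg:
  assumes "local_lipschitz_const \<epsilon> \<gamma> T = ereal L"
  shows "0 \<le> L"
proof -
  have "{(y, z). y \<in> T \<and> 0 < norm (z - y) \<and> norm (z - y) \<le> \<epsilon>} \<noteq> {}"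
    using assms unfolding local_lipschitz_const_def
    by (metis (no_types, lifting) MInfty_neq_ereal(1) SUP_empty bot_ereal_def)
  then obtain y z where yz: "y \<in> T" "0 < norm (z - y)" "norm (z - y) \<le> \<epsilon>"
    by blast
  then have "0 \<le> L * norm (z - y)"
    using local_lipschitz_const_bound[OF assms yz(1,3)] norm_ge_zero order_trans by blast
  with yz(2) show ?thesis
    by (simp add: zero_le_mult_iff)
qed

lemma stability_const_le:
  assumes "\<gamma> \<circ> \<phi> \<in> reconstructors A X \<eta>"
    and "contracts_errors A X \<epsilon> \<phi> C"
    and L: "local_lipschitz_const \<epsilon> \<gamma> (\<phi> ` (\<lambda>x. A *v x) ` X) = ereal L"
  shows "stability_const A X \<epsilon> \<eta> (\<gamma> \<circ> \<phi>) \<le> ereal (L * C)"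
proof -
  have "(norm ((\<gamma> \<circ> \<phi>) (A *v x + e) - x) - \<eta>) / norm e \<le> L * C"
    if x: "x \<in> X" and e: "0 < norm e" "norm e \<le> \<epsilon>" for x e
  proof -
    let ?d = "norm (\<phi> (A *v x + e) - \<phi> (A *v x))"
    have C: "0 \<le> C" "C < 1" and d: "?d \<le> C * norm e"
      using assms(2) x e by (auto simp: contracts_errors_iff)
    \<comment> \<open>Contraction keeps the perturbed value of \<open>\<phi>\<close> within the
      radius \<open>\<epsilon>\<close> on which \<open>L\<close> is valid.\<close>
    have "C * norm e \<le> norm e"
      using C by (simp add: mult_left_le_one_le)
    with d e have d_le: "?d \<le> \<epsilon>"
      by linarith
    \<comment> \<open>Passing through the reconstruction from exact data splits off an error of at
      most \<open>\<eta>\<close>, which the numerator subtracts again.\<close>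
    have "norm ((\<gamma> \<circ> \<phi>) (A *v x + e) - x)
        \<le> norm (\<gamma> (\<phi> (A *v x + e)) - \<gamma> (\<phi> (A *v x))) + norm ((\<gamma> \<circ> \<phi>) (A *v x) - x)"
      by (rule norm_diff_triangle_le) auto
    also have "\<dots> \<le> L * ?d + \<eta>"
      using x d_le by (intro add_mono reconstructors_error_le[OF assms(1)]
        local_lipschitz_const_bound[OF L]) auto
    also have "L * ?d \<le> L * (C * norm e)"
      using d local_lipschitz_const_nonneg[OF L] by (rule mult_left_mono)
    finally show ?thesis
      using e by (simp add: pos_divide_le_eq mult.assoc)
  qed
  then show ?thesis
    unfolding stability_const_def by (intro SUP_least) auto
qed

theorem theorem3p2:
  fixes A :: "real^'n^'m" and X :: "(real^'n) set" and Y :: "(real^'m) set"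
    and \<epsilon> \<eta>\<^sub>1 \<eta>\<^sub>2 :: real
    and \<Psi>\<^sub>1 \<Psi>\<^sub>2 :: "real^'m \<Rightarrow> real^'n"
    and \<phi>\<^sub>1 :: "real^'m \<Rightarrow> real^'t" and \<gamma>\<^sub>1 :: "real^'t \<Rightarrow> real^'n"
    and T :: "(real^'t) set"
  assumes "CARD('n) \<le> CARD('m)"
    and "rank A = CARD('n)"
    and "Y = {A *v x | x. x \<in> X}"
    and "\<not> (\<exists>y. y isolated_in Y)"
    and "\<epsilon> > 0" and "\<eta>\<^sub>1 > 0" and "\<eta>\<^sub>2 > 0"
    and "\<Psi>\<^sub>1 \<in> stabilized_reconstructors TYPE('t) A X \<epsilon> \<eta>\<^sub>1"
    and "\<Psi>\<^sub>1 = \<gamma>\<^sub>1 \<circ> \<phi>\<^sub>1"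
    and "is_stabilizer A X \<epsilon> \<Psi>\<^sub>1 \<phi>\<^sub>1"
    and "\<Psi>\<^sub>2 \<in> reconstructors A X \<eta>\<^sub>2"
    and "\<bar>stability_const A X \<epsilon> \<eta>\<^sub>1 \<Psi>\<^sub>1\<bar> \<noteq> \<infinity>"
    and "\<bar>stability_const A X \<epsilon> \<eta>\<^sub>2 \<Psi>\<^sub>2\<bar> \<noteq> \<infinity>"
    and "T = \<phi>\<^sub>1 ` Y"
    and "\<bar>local_lipschitz_const \<epsilon> \<gamma>\<^sub>1 T\<bar> \<noteq> \<infinity>"
    and "local_lipschitz_const \<epsilon> \<gamma>\<^sub>1 T \<noteq> 0"
    and "ereal (stabilizer_const A X \<epsilon> \<phi>\<^sub>1)
           \<in> {0 .. stability_const A X \<epsilon> \<eta>\<^sub>2 \<Psi>\<^sub>2 / local_lipschitz_const \<epsilon> \<gamma>\<^sub>1 T}"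
  shows "stability_const A X \<epsilon> \<eta>\<^sub>1 \<Psi>\<^sub>1 \<le> stability_const A X \<epsilon> \<eta>\<^sub>2 \<Psi>\<^sub>2"
proof -
  let ?C = "stabilizer_const A X \<epsilon> \<phi>\<^sub>1"
  obtain L where L: "local_lipschitz_const \<epsilon> \<gamma>\<^sub>1 T = ereal L"
    using assms(15) by auto
  obtain S where S: "stability_const A X \<epsilon> \<eta>\<^sub>2 \<Psi>\<^sub>2 = ereal S"
    using assms(13) by auto
  \<comment> \<open>Strict positivity lets the quotient bounding \<open>?C\<close> be cleared
    without reversing the inequality.\<close>
  have "0 < L"
    using local_lipschitz_const_nonneg[OF L] assms(16) L by (simp add: zero_ereal_def)
  have "contracts_errors A X \<epsilon> \<phi>\<^sub>1 ?C"
    using assms(10) contracts_errors_stabilizer_const unfolding is_stabilizer_def by blast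
  moreover have "\<gamma>\<^sub>1 \<circ> \<phi>\<^sub>1 \<in> reconstructors A X \<eta>\<^sub>1"
    using assms(8,9) by (simp add: stabilized_reconstructors_def)
  moreover have "T = \<phi>\<^sub>1 ` (\<lambda>x. A *v x) ` X"
    using assms(3,14) by auto
  ultimately have "stability_const A X \<epsilon> \<eta>\<^sub>1 \<Psi>\<^sub>1 \<le> ereal (L * ?C)"
    using stability_const_le L assms(9) by blast
  also have "L * ?C \<le> S"
    using assms(17) \<open>0 < L\<close> by (simp add: L S pos_le_divide_eq mult.commute)
  finally show ?thesis
    by (simp add: S)
qed

end
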